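(* Let $X$ be a finite-velocity random motion moving with velocities $v_0,\dots,v_M\in\mathbb{R}^D$, $M\in\mathbb{N}$, governed by a non-homogeneous Poisson process $N$ with rate function $\lambda\in C^M([0,\infty),[0,\infty))$ such that $\Lambda(t)=\int_0^t\lambda(s)\,ds<\infty$ for $t\ge 0$. Let $p_i=P\{V(0)=v_i\}>0$ and $p_{i,j}=P\{V(t+dt)=v_j\mid V(t)=v_i,\ N(t,t+dt]=1\}\ge 0$ for each $i,j=0,\dots,M$ and all $t$. Let $H\in\{0,\dots,M-1\}$, let $I_H=\{i_0,\dots,i_H\}\subset\{0,\dots,M\}$ be a set of $H+1$ distinct indices and $I_{H^-}=\{0,\dots,M\}\setminus I_H$. Suppose that there is a constant $\alpha_{I_H}>0$ such that $$\sum_{j\in I_H}p_{i_k,j}=P\big\{V(t+dt)\in\{v_{i_0},\dots,v_{i_H}\}\mid V(t)=v_{i_k},\ N(t,t+dt]=1\big\}=\alpha_{I_H}$$ for $k=0,\dots,H$ and $t\ge 0$. Then, with $R=\dim\big(\mathrm{Conv}(v_{i_0},\dots,v_{i_H})\big)\le D$, there exists an orthogonal projection $p_R:\mathbb{R}^D\to\mathbb{R}^R$ such that, for $t\ge 0$ and $x$ in the relative interior of $\mathrm{Conv}(v_{i_0}t,\dots,v_{i_H}t)$, with $x^R=p_R(x)$, $$P\Big\{X(t)\in dx\ \Big|\ \bigcap_{j\in I_{H^-}}\{N_j(t)=0\}\Big\}\Big/dx=P\big\{Y^R(t)\in dx^R\big\}\big/dx^R,$$ where $Y^R$ is an $R$-dimensional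 finite-velocity random motion governed by a non-homogeneous Poisson process with rate function $\lambda\alpha_{I_H}$, moving with velocities $v_{i_0}^R=p_R(v_{i_0}),\dots,v_{i_H}^R=p_R(v_{i_H})$, and such that its initial and transition probabilities are $p_i^Y=p_i/\sum_{j\in I_H}p_j$ and $p_{i,j}^Y=p_{i,j}/\alpha_{I_H}$ for all $i,j\in I_H$.
   Context: Random motion. Let $N$ be a point process with event times $0=T_0\le T_1\le T_2\le\dots$ and $N(t)=\max\{n\ge0:T_n\le t\}$, and let $V=\{V(t)\}_{t\ge 0}$ take values in a finite set $\{v_0,\dots,v_M\}\subset\mathbb{R}^D$ and change value only when $N$ records an event, so $V(t)=V(T_{N(t)})$. The finite-velocity random motion with velocity $V$ governed by $N$ is $X(t)=\int_0^tV(s)\,ds$. Here, at each event of $N$ the new velocity is selected, given the past, with probabilities depending only on the current velocity: from $v_i$ it becomes $v_j$ with probability $p_{i,j}$ (possibly $j=i$), independently of $N$; i.e. $(V(T_n))_{n\ge0}$ is a Markov chain independent of $N$ with initial law $(p_i)$ and transition matrix $(p_{i,j})$. The motion $Y^R$ is of the same type, with index set $I_H$, velocity $v_i^R$ for index $i$, initial probabilities $p_i^Y$ and transition probabilities $p_{i,j}^Y$. Notation. $N_j(t)=|\{0\le l\le N(t):V(T_l)=v_j\}|$ counts the displacements with velocity $v_j$ in $[0,t]$. "Orthogonal projection $p_R:\mathbb{R}^D\to\mathbb{R}^R$" means a coordinate projection keeping $R$ of the $D$ standard coordinates, which is injective on $\mathrm{Conv}(v_{i_0}t,\dots,v_{i_H}t)$.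 The left-hand "density" is with respect to the coordinates $x^R=p_R(x)$, i.e. the displayed identity says that, on the relative interior of $\mathrm{Conv}(v_{i_0}t,\dots,v_{i_H}t)$, the conditional law of $X(t)$ corresponds under $p_R$ to the law of $Y^R(t)$. *)

theory Defs
  imports "HOL-Probability.Probability"
begin

text \<open>\<open>k\<close> times continuously differentiable on \<open>S\<close>, with one-sided derivatives at boundary
  points; \<open>g i\<close> is the \<open>i\<close>-th derivative.\<close>

definition Ck_on :: "nat \<Rightarrow> real set \<Rightarrow> (real \<Rightarrow> real) \<Rightarrow> bool" where
  "Ck_on k S f \<longleftrightarrow> (\<exists>g :: nat \<Rightarrow> real \<Rightarrow> real.
     (\<forall>x\<in>S. g 0 x = f x) \<and>
     (\<forall>i<k. \<forall>x\<in>S. (g i has_real_derivative g (Suc i) x) (at x within S)) \<and>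
     (\<forall>i\<le>k. continuous_on S (g i)))"

text \<open>Event times are extended reals: \<open>T n = \<infinity>\<close> means that fewer than \<open>n\<close> events ever occur, which
  has positive probability for a Poisson process whose rate is integrable on \<open>[0,\<infinity>)\<close>.\<close>

locale point_process = prob_space M for M :: "'w measure" +
  fixes T :: "nat \<Rightarrow> 'w \<Rightarrow> ereal"
  assumes event_time_measurable: "\<And>n. T n \<in> borel_measurable M"
    and event_time_0: "\<And>\<omega>. \<omega> \<in> space M \<Longrightarrow> T 0 \<omega> = 0"
    and event_time_mono: "\<And>\<omega>. \<omega> \<in> space M \<Longrightarrow> incseq (\<lambda>n. T n \<omega>)"
    and locally_finite: "\<And>\<omega> t. \<omega> \<in> space M \<Longrightarrow> finite {n. T n \<omega> \<le> ereal t}"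

definition event_count :: "(nat \<Rightarrow> 'w \<Rightarrow> ereal) \<Rightarrow> real \<Rightarrow> 'w \<Rightarrow> nat" where
  "event_count T t \<omega> = Max {n. T n \<omega> \<le> ereal t}"

text \<open>The Poisson weights are written out so that the mean may be \<open>0\<close> (with \<open>0 ^ 0 = 1\<close>).\<close>

locale nonhom_poisson_process = point_process M T
  for M :: "'w measure" and T :: "nat \<Rightarrow> 'w \<Rightarrow> ereal" +
  fixes rate :: "real \<Rightarrow> real"
  assumes no_event_at_0: "AE \<omega> in M. event_count T 0 \<omega> = 0"
    and independent_increments:
      "\<And>n \<tau>. incseq \<tau> \<Longrightarrow> 0 \<le> \<tau> 0 \<Longrightarrow>
        indep_vars (\<lambda>_. count_space UNIV)
          (\<lambda>k \<omega>. event_count T (\<tau> (Suc k)) \<omega> - event_count T (\<tau> k) \<omega>) {..<n::nat}"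
    and poisson_increments:
      "\<And>s t k. 0 \<le> s \<Longrightarrow> s \<le> t \<Longrightarrow>
        \<P>(\<omega> in M. event_count T t \<omega> - event_count T s \<omega> = k) =
          exp (- integral {s..t} rate) * integral {s..t} rate ^ k / fact k"

text \<open>Homogeneous Markov chain on the finite index set \<open>I\<close> with initial law \<open>p\<close> and transition
  matrix \<open>q\<close>.\<close>

locale finite_markov_chain = prob_space M for M :: "'w measure" +
  fixes J :: "nat \<Rightarrow> 'w \<Rightarrow> nat" and I :: "nat set"
    and p :: "nat \<Rightarrow> real" and q :: "nat \<Rightarrow> nat \<Rightarrow> real"
  assumes finite_index: "finite I"
    and initial_nonneg: "\<And>i. i \<in> I \<Longrightarrow> 0 \<le> p i"
    and initial_sum: "(\<Sum>i\<in>I. p i) = 1"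
    and transition_nonneg: "\<And>i j. i \<in> I \<Longrightarrow> j \<in> I \<Longrightarrow> 0 \<le> q i j"
    and transition_sum: "\<And>i. i \<in> I \<Longrightarrow> (\<Sum>j\<in>I. q i j) = 1"
    and chain_measurable: "\<And>n. J n \<in> measurable M (count_space UNIV)"
    and chain_in: "\<And>n \<omega>. \<omega> \<in> space M \<Longrightarrow> J n \<omega> \<in> I"
    and initial_law: "\<And>i. i \<in> I \<Longrightarrow> \<P>(\<omega> in M. J 0 \<omega> = i) = p i"
    and markov:
      "\<And>n a j. (\<And>k. k \<le> n \<Longrightarrow> a k \<in> I) \<Longrightarrow> j \<in> I \<Longrightarrow>
        0 < \<P>(\<omega> in M. \<forall>k\<le>n. J k \<omega> = a k) \<Longrightarrow>
        \<P>(\<omega> in M. J (Suc n) \<omega> = j \<bar> \<forall>k\<le>n. J k \<omega> = a k) = q (a n) j"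

text \<open>The randomness driving a finite-velocity motion: \<open>J n\<close> is the index of the velocity selected at
  the \<open>n\<close>-th event. The velocities themselves enter only below, so that the same locale serves
  motions in spaces of different dimension. Independence of the counting process and the chain is
  independence of the sequences of event times and of indices.\<close>

locale velocity_driver =
  nonhom_poisson_process M T rate + finite_markov_chain M J I p q
  for M :: "'w measure" and T :: "nat \<Rightarrow> 'w \<Rightarrow> ereal" and rate :: "real \<Rightarrow> real"
    and J :: "nat \<Rightarrow> 'w \<Rightarrow> nat" and I :: "nat set"
    and p :: "nat \<Rightarrow> real" and q :: "nat \<Rightarrow> nat \<Rightarrow> real" +
  assumes chain_independent:
    "indep_var (Pi\<^sub>M UNIV (\<lambda>_. borel)) (\<lambda>\<omega> n. T n \<omega>)
       (Pi\<^sub>M UNIV (\<lambda>_. count_space UNIV)) (\<lambda>\<omega> n. J n \<omega>)"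

definition velocity ::
  "(nat \<Rightarrow> 'v) \<Rightarrow> (nat \<Rightarrow> 'w \<Rightarrow> ereal) \<Rightarrow> (nat \<Rightarrow> 'w \<Rightarrow> nat) \<Rightarrow> real \<Rightarrow> 'w \<Rightarrow> 'v" where
  "velocity v T J t \<omega> = v (J (event_count T t \<omega>) \<omega>)"

definition displacement_count ::
  "(nat \<Rightarrow> 'v) \<Rightarrow> (nat \<Rightarrow> 'w \<Rightarrow> ereal) \<Rightarrow> (nat \<Rightarrow> 'w \<Rightarrow> nat) \<Rightarrow> nat \<Rightarrow> real \<Rightarrow> 'w \<Rightarrow> nat" where
  "displacement_count v T J j t \<omega> = card {l. l \<le> event_count T t \<omega> \<and> v (J l \<omega>) = v j}"

definition motion ::
  "(nat \<Rightarrow> real ^ 'd) \<Rightarrow> (nat \<Rightarrow> 'w \<Rightarrow> ereal) \<Rightarrow> (nat \<Rightarrow> 'w \<Rightarrow> nat) \<Rightarrow> real \<Rightarrow> 'w \<Rightarrow> real ^ 'd" where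
  "motion v T J t \<omega> = integral {0..t} (\<lambda>s. velocity v T J s \<omega>)"

text \<open>The dimension \<open>R\<close> below is computed from the velocities and may be \<open>0\<close>, so it cannot be a
  type. \<open>\<real>\<^sup>R\<close> is therefore the set \<open>{..<R} \<rightarrow>\<^sub>E UNIV\<close> of extensional functions, and the motion in it is
  the coordinatewise integral of its velocity.\<close>

definition motion_coords ::
  "nat \<Rightarrow> (nat \<Rightarrow> nat \<Rightarrow> real) \<Rightarrow> (nat \<Rightarrow> 'w \<Rightarrow> ereal) \<Rightarrow> (nat \<Rightarrow> 'w \<Rightarrow> nat) \<Rightarrow>
    real \<Rightarrow> 'w \<Rightarrow> nat \<Rightarrow> real" where
  "motion_coords R w T J t \<omega> = (\<lambda>k\<in>{..<R}. integral {0..t} (\<lambda>s. velocity w T J s \<omega> k))"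

text \<open>Projection of \<open>\<real>\<^sup>D\<close> onto \<open>\<real>\<^sup>R\<close> keeping \<open>R\<close> distinct standard coordinates.\<close>

definition coordinate_projection :: "nat \<Rightarrow> (real ^ 'd \<Rightarrow> nat \<Rightarrow> real) \<Rightarrow> bool" where
  "coordinate_projection R pr \<longleftrightarrow>
     (\<exists>\<sigma> :: nat \<Rightarrow> 'd. inj_on \<sigma> {..<R} \<and> pr = (\<lambda>x. \<lambda>k\<in>{..<R}. x $ \<sigma> k))"

end

theory Submission
  imports Defs
begin

text \<open>The conditioning event says that only indices in \<open>I\<close> are used up to time \<open>t\<close>. Given that there are
\<open>n\<close> events before \<open>t\<close>, at times \<open>T 1, \<dots>, T n\<close>, and that the indices are \<open>a 0, \<dots>, a n\<close>, the position at
time \<open>t\<close> is the sum of the velocities \<open>v (a l)\<close> weighted by the lengths of the time intervals between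
events (\<open>velocity_has_integral\<close>). So it is enough to compare, path by path, the driver of the given
motion with a driver that has rate \<open>\<alpha> * lam\<close>, index set \<open>I\<close> and probabilities rescaled by
\<open>S = (\<Sum>j\<in>I. p j)\<close> and \<open>\<alpha>\<close>.

Let \<open>\<Lambda>\<close> be the integral of \<open>lam\<close> over \<open>[0,t]\<close>. Multiplying the rate of a Poisson process by \<open>\<alpha>\<close>
multiplies the law of the event times on the event of having exactly \<open>n\<close> of them in \<open>[0,t]\<close> by
\<open>exp ((1 - \<alpha>) * \<Lambda>) * \<alpha> ^ n\<close>. For the counts on a grid this is read off the Poisson weights
(\<open>grid_ratio\<close>); the counts determine the joint distribution function of the event times
(\<open>event_times_ratio\<close>), and Dynkin's theorem does the rest (\<open>clipped_times_ratio\<close>). In this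
way neither densities nor order statistics of the event times enter. Rescaling the chain
multiplies the probability of the index path \<open>a 0, \<dots>, a n\<close> by \<open>1 / (S * \<alpha> ^ n)\<close>. The powers of \<open>\<alpha>\<close>
cancel, and every path is reweighted by the same constant \<open>exp ((1 - \<alpha>) * \<Lambda>) / S\<close>
(\<open>restricted_motion_proportional\<close>). Hence the two laws of the position agree after normalisation
(\<open>conditioned_motion_law\<close>).

This compares motions in the original space. A coordinate projection that is injective on the convex
hulls exists by linear algebra (\<open>coordinate_projection_injective_on_hull\<close>); since integration is
coordinatewise, it carries the second motion to the motion with projected velocities.\<close>

section \<open>Event counts and event times\<close>

context point_process
begin

lemma le_event_count_iff:
  assumes "\<omega> \<in> space M" "0 \<le> t"
  shows "n \<le> event_count T t \<omega> \<longleftrightarrow> T n \<omega> \<le> ereal t"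
proof -
  let ?S = "{n. T n \<omega> \<le> ereal t}"
  have fin: "finite ?S" using locally_finite assms(1) by blast
  have "0 \<in> ?S" using event_time_0[OF assms(1)] assms(2) by simp
  then have max: "event_count T t \<omega> \<in> ?S"
    unfolding event_count_def using Max_in[OF fin] by blast
  show ?thesis
  proof
    assume "n \<le> event_count T t \<omega>"
    then have "T n \<omega> \<le> T (event_count T t \<omega>) \<omega>"
      using event_time_mono[OF assms(1)] by (auto dest: incseqD)
    with max show "T n \<omega> \<le> ereal t" by auto
  next
    assume "T n \<omega> \<le> ereal t"
    then show "n \<le> event_count T t \<omega>"
      unfolding event_count_def using fin by (intro Max_ge) auto
  qed
qed

lemma event_count_eq_iff:
  assumes "\<omega> \<in> space M" "0 \<le> t"
  shows "event_count T t \<omega> = n \<longleftrightarrow> T n \<omega> \<le> ereal t \<and> \<not> T (Suc n) \<omega> \<le> ereal t"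
  unfolding le_event_count_iff[OF assms, symmetric] by auto

lemma event_count_mono:
  assumes "\<omega> \<in> space M" "0 \<le> s" "s \<le> t"
  shows "event_count T s \<omega> \<le> event_count T t \<omega>"
  using assms le_event_count_iff[of \<omega> s "event_count T s \<omega>"]
    le_event_count_iff[of \<omega> t "event_count T s \<omega>"] order_trans by fastforce

lemma event_count_measurable:
  assumes "0 \<le> t"
  shows "event_count T t \<in> measurable M (count_space UNIV)"
proof -
  note event_time_measurable[measurable]
  have "event_count T t -` {n} \<inter> space M
      = {\<omega>\<in>space M. T n \<omega> \<le> ereal t \<and> \<not> T (Suc n) \<omega> \<le> ereal t}" for n
    using event_count_eq_iff[OF _ assms] by auto
  moreover have "{\<omega>\<in>space M. T n \<omega> \<le> ereal t \<and> \<not> T (Suc n) \<omega> \<le> ereal t} \<in> sets M" for n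
    by measurable
  ultimately show ?thesis by (simp add: measurable_count_space_eq2_countable)
qed

end

section \<open>The motion as a function of event times and indices\<close>

text \<open>Event times may be infinite, and those after \<open>t\<close> do not influence the motion up to time \<open>t\<close>.
Cutting them off at \<open>t\<close> makes them real, and turns the last, unfinished displacement into one
that ends exactly at \<open>t\<close>, so that all displacements have the same form.\<close>

definition clip :: "real \<Rightarrow> ereal \<Rightarrow> real" where
  "clip t x = real_of_ereal (min x (ereal t))"

lemma clip_measurable [measurable]: "clip t \<in> borel_measurable borel"
  unfolding clip_def by measurable

lemma clip_of_ge: "\<not> x \<le> ereal t \<Longrightarrow> clip t x = t"
  by (simp add: clip_def min_def)

lemma ereal_clip:
  assumes "0 \<le> x" "x \<le> ereal t"
  shows "ereal (clip t x) = x"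
  using assms by (cases x) (auto simp: clip_def min_def)

lemma clip_bounds:
  assumes "0 \<le> x" "0 \<le> t"
  shows "0 \<le> clip t x" "clip t x \<le> t"
  using assms by (cases x; auto simp: clip_def min_def)+

lemma clip_mono:
  assumes "0 \<le> x" "x \<le> y"
  shows "clip t x \<le> clip t y"
  using assms by (cases x; cases y; auto simp: clip_def min_def)

lemma clip_le_iff:
  assumes "0 \<le> x" "0 \<le> s" "s < t"
  shows "clip t x \<le> s \<longleftrightarrow> x \<le> ereal s"
  using assms by (cases x; auto simp: clip_def min_def)

text \<open>The position after \<open>n\<close> changes of velocity, when \<open>u l\<close> is the time of the \<open>l\<close>-th change and
\<open>u (Suc n)\<close> is the final time.\<close>

definition endpoint :: "(nat \<Rightarrow> 'v::real_vector) \<Rightarrow> (nat \<Rightarrow> nat) \<Rightarrow> (nat \<Rightarrow> real) \<Rightarrow> nat \<Rightarrow> 'v" where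
  "endpoint v a u n = (\<Sum>l\<le>n. (u (Suc l) - u l) *\<^sub>R v (a l))"

context point_process
begin

lemma event_time_nonneg: "\<omega> \<in> space M \<Longrightarrow> 0 \<le> T n \<omega>"
  using event_time_mono[of \<omega>] event_time_0[of \<omega>] by (metis incseqD le0)

text \<open>Between two consecutive clipped event times the velocity is constant, except at the right end
point, where it has already switched; a single point does not affect the integral.\<close>

lemma velocity_has_integral:
  fixes v :: "nat \<Rightarrow> 'v::banach"
  assumes \<omega>: "\<omega> \<in> space M" and t: "0 \<le> t"
  shows "((\<lambda>s. velocity v T J s \<omega>) has_integral
           endpoint v (\<lambda>l. J l \<omega>) (\<lambda>l. clip t (T l \<omega>)) (event_count T t \<omega>)) {0..t}"
proof -
  define u where "u = (\<lambda>l. clip t (T l \<omega>))"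
  define N where "N = event_count T t \<omega>"
  have u_mono: "u l \<le> u (Suc l)" for l
    unfolding u_def using event_time_mono[OF \<omega>] event_time_nonneg[OF \<omega>]
    by (intro clip_mono) (auto simp: incseq_def)
  have u0: "u 0 = 0" using t by (simp add: u_def event_time_0[OF \<omega>] clip_def min_def)
  have u_nonneg: "0 \<le> u l" for l
    unfolding u_def by (rule clip_bounds) (use event_time_nonneg[OF \<omega>] t in auto)
  have uN: "u (Suc N) = t"
    using event_count_eq_iff[OF \<omega> t, of N] unfolding u_def N_def by (intro clip_of_ge) auto
  have piece: "((\<lambda>s. velocity v T J s \<omega>) has_integral (u (Suc l) - u l) *\<^sub>R v (J l \<omega>)) {u l..u (Suc l)}"
    if "l \<le> N" for l
  proof (rule has_integral_spike_finite[where S = "{u (Suc l)}" and f = "\<lambda>_. v (J l \<omega>)"])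
    show "((\<lambda>_. v (J l \<omega>)) has_integral (u (Suc l) - u l) *\<^sub>R v (J l \<omega>)) {u l..u (Suc l)}"
      using has_integral_const_real[of "v (J l \<omega>)" "u l" "u (Suc l)"] u_mono[of l] by simp
    fix s assume s: "s \<in> {u l..u (Suc l)} - {u (Suc l)}"
    have "T l \<omega> \<le> ereal t" using that le_event_count_iff[OF \<omega> t] by (simp add: N_def)
    then have Tl: "T l \<omega> = ereal (u l)"
      using ereal_clip[OF event_time_nonneg[OF \<omega>]] by (simp add: u_def)
    have s0: "0 \<le> s" using s u_nonneg[of l] by auto
    have "\<not> T (Suc l) \<omega> \<le> ereal s"
    proof
      assume *: "T (Suc l) \<omega> \<le> ereal s"
      have "s < t"
        using s clip_bounds(2)[OF event_time_nonneg[OF \<omega>] t, of "Suc l"] by (auto simp: u_def)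
      then have "u (Suc l) \<le> s"
        using * clip_le_iff[OF event_time_nonneg[OF \<omega>] s0, of t "Suc l"] by (simp add: u_def)
      then show False using s by auto
    qed
    moreover have "T l \<omega> \<le> ereal s" using s Tl by simp
    ultimately have "event_count T s \<omega> = l" using event_count_eq_iff[OF \<omega> s0] by blast
    then show "velocity v T J s \<omega> = v (J l \<omega>)" by (simp add: velocity_def)
  qed auto
  have "((\<lambda>s. velocity v T J s \<omega>) has_integral endpoint v (\<lambda>l. J l \<omega>) u n) {0..u (Suc n)}"
    if "n \<le> N" for n
    using that
  proof (induction n)
    case 0
    then show ?case using piece[of 0] by (simp add: endpoint_def u0)
  next
    case (Suc n)
    have "((\<lambda>s. velocity v T J s \<omega>) has_integral
        endpoint v (\<lambda>l. J l \<omega>) u n + (u (Suc (Suc n)) - u (Suc n)) *\<^sub>R v (J (Suc n) \<omega>))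
        {0..u (Suc (Suc n))}"
      by (rule has_integral_combine[OF u_nonneg u_mono]) (use Suc piece[of "Suc n"] in auto)
    then show ?case by (simp add: endpoint_def)
  qed
  from this[of N] show ?thesis by (simp add: uN) (simp add: u_def N_def)
qed

text \<open>The displacement times sum to \<open>t\<close>, so for \<open>t > 0\<close> the end point is the convex combination of the
points \<open>t *\<^sub>R v i\<close> with weights proportional to them.\<close>

lemma endpoint_in_convex_hull:
  fixes v :: "nat \<Rightarrow> 'v::real_vector"
  assumes \<omega>: "\<omega> \<in> space M" and t: "0 \<le> t"
    and J: "\<And>l. l \<le> event_count T t \<omega> \<Longrightarrow> J l \<in> K"
  shows "endpoint v J (\<lambda>l. clip t (T l \<omega>)) (event_count T t \<omega>)
    \<in> convex hull ((\<lambda>i. t *\<^sub>R v i) ` K)"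
proof -
  define u where "u = (\<lambda>l. clip t (T l \<omega>))"
  define N where "N = event_count T t \<omega>"
  have u_mono: "u l \<le> u (Suc l)" for l
    unfolding u_def using event_time_mono[OF \<omega>] event_time_nonneg[OF \<omega>]
    by (intro clip_mono) (auto simp: incseq_def)
  have u0: "u 0 = 0" using t by (simp add: u_def event_time_0[OF \<omega>] clip_def min_def)
  have uN: "u (Suc N) = t"
    using event_count_eq_iff[OF \<omega> t, of N] unfolding u_def N_def by (intro clip_of_ge) auto
  have sum: "(\<Sum>l\<le>N. u (Suc l) - u l) = t"
    using sum_lessThan_telescope[of u "Suc N"] by (simp add: lessThan_Suc_atMost u0 uN)
  have "endpoint v J u N \<in> convex hull ((\<lambda>i. t *\<^sub>R v i) ` K)"
  proof (cases "t = 0")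
    case True
    \<comment> \<open>For \<open>t = 0\<close> there are no such weights, but every displacement vanishes.\<close>
    have "u (Suc l) - u l = 0" for l
      using clip_bounds[OF event_time_nonneg[OF \<omega>] t] True unfolding u_def
      by (metis diff_self order_antisym)
    then have "endpoint v J u N = t *\<^sub>R v (J 0)" using True by (simp add: endpoint_def)
    also have "\<dots> \<in> (\<lambda>i. t *\<^sub>R v i) ` K" using J[of 0] by auto
    finally show ?thesis by (rule hull_inc)
  next
    case False
    have "endpoint v J u N = (\<Sum>l\<le>N. ((u (Suc l) - u l) / t) *\<^sub>R (t *\<^sub>R v (J l)))"
      using False by (simp add: endpoint_def)
    also have "\<dots> \<in> convex hull ((\<lambda>i. t *\<^sub>R v i) ` K)"
    proof (rule convex_sum)
      show "(\<Sum>l\<le>N. (u (Suc l) - u l) / t) = 1"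
        using False sum by (simp flip: sum_divide_distrib)
      show "0 \<le> (u (Suc l) - u l) / t" for l using u_mono t by simp
      show "t *\<^sub>R v (J l) \<in> convex hull ((\<lambda>i. t *\<^sub>R v i) ` K)" if "l \<in> {..N}" for l
        using J[of l] that by (auto simp: N_def intro!: hull_inc)
    qed auto
    finally show ?thesis .
  qed
  then show ?thesis by (simp add: u_def N_def)
qed

end

section \<open>Paths of the Markov chain\<close>

context finite_markov_chain
begin

lemma path_probability:
  assumes "\<And>k. k \<le> n \<Longrightarrow> a k \<in> I"
  shows "\<P>(\<omega> in M. \<forall>k\<le>n. J k \<omega> = a k) = p (a 0) * (\<Prod>k<n. q (a k) (a (Suc k)))"
  using assms
proof (induction n)
  case 0
  then show ?case by (simp add: initial_law)
next
  case (Suc n)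
  let ?E = "\<lambda>\<omega>. \<forall>k\<le>n. J k \<omega> = a k"
  have eq: "(\<forall>k\<le>Suc n. J k \<omega> = a k) \<longleftrightarrow> J (Suc n) \<omega> = a (Suc n) \<and> ?E \<omega>" for \<omega>
    using le_Suc_eq by auto
  note chain_measurable[measurable]
  have IH: "prob {\<omega>\<in>space M. ?E \<omega>} = p (a 0) * (\<Prod>k<n. q (a k) (a (Suc k)))"
    using Suc by simp
  show ?case
  proof (cases "prob {\<omega>\<in>space M. ?E \<omega>} = 0")
    case True
    \<comment> \<open>A path of probability \<open>0\<close> gives no transition probability, but its extensions are null too.\<close>
    have "prob {\<omega>\<in>space M. J (Suc n) \<omega> = a (Suc n) \<and> ?E \<omega>} \<le> prob {\<omega>\<in>space M. ?E \<omega>}"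
      by (rule finite_measure_mono) auto
    then have "prob {\<omega>\<in>space M. J (Suc n) \<omega> = a (Suc n) \<and> ?E \<omega>} = 0"
      using True by (simp add: order_antisym)
    with True IH show ?thesis by (auto simp: eq)
  next
    case False
    then have pos: "0 < prob {\<omega>\<in>space M. ?E \<omega>}" by (simp add: zero_less_measure_iff)
    have "\<P>(\<omega> in M. J (Suc n) \<omega> = a (Suc n) \<bar> ?E \<omega>) = q (a n) (a (Suc n))"
      by (rule markov) (use Suc.prems pos in auto)
    then have "prob {\<omega>\<in>space M. J (Suc n) \<omega> = a (Suc n) \<and> ?E \<omega>}
        = q (a n) (a (Suc n)) * prob {\<omega>\<in>space M. ?E \<omega>}"
      using False by (simp add: cond_prob_def field_simps)
    then show ?thesis by (simp add: eq IH)
  qed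
qed

end

section \<open>An injective coordinate projection\<close>

text \<open>A basis of the orthogonal complement \<open>W\<close> of \<open>V\<close> can be completed to a basis of the whole space by
\<open>dim V\<close> standard basis vectors. A vector of \<open>V\<close> whose coordinates along these vanish is
orthogonal to that whole basis, hence is \<open>0\<close>.\<close>

lemma coordinates_injective_on_subspace:
  fixes V :: "(real ^ 'd) set"
  assumes V: "subspace V"
  shows "\<exists>\<sigma> :: nat \<Rightarrow> 'd. inj_on \<sigma> {..<dim V} \<and>
    (\<forall>x\<in>V. (\<forall>k<dim V. x $ \<sigma> k = 0) \<longrightarrow> x = 0)"
proof -
  define W where "W = {y. \<forall>x\<in>V. orthogonal x y}"
  have dimW: "dim W + dim V = CARD('d)"
    using dim_subspace_orthogonal_to_vectors[OF V subspace_UNIV] by (simp add: W_def)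
  obtain B where B: "B \<subseteq> W" "independent B" "W \<subseteq> span B" "card B = dim W"
    using basis_exists by blast
  obtain C where C: "B \<subseteq> C" "C \<subseteq> B \<union> Basis" "independent C" "B \<union> Basis \<subseteq> span C"
    using maximal_independent_subset_extend[of B "B \<union> Basis"] B by auto
  have "span C = UNIV"
    using C(4) span_minimal[of Basis "span C"] span_Basis by auto
  then have "card C = CARD('d)"
    using dim_span_eq_card_independent[OF C(3)] dim_UNIV by (metis DIM_cart DIM_real dim_UNIV mult_1_right)
  moreover have "finite C" using C(3) independent_imp_finite by blast
  ultimately have card: "card (C - B) = dim V"
    using card_Diff_subset[of B C] C(1) B(4) dimW finite_subset by fastforce
  have axes: "\<exists>i. c = axis i 1" if "c \<in> C - B" for c
    using that C(2) by (auto simp: Basis_vec_def)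
  then obtain ix where ix: "\<And>c. c \<in> C - B \<Longrightarrow> c = axis (ix c) 1" by metis
  obtain e where e: "bij_betw e {..<dim V} (C - B)"
    using ex_bij_betw_nat_finite[of "C - B"] \<open>finite C\<close> card by (auto simp: atLeast0LessThan)
  define \<sigma> where "\<sigma> = ix \<circ> e"
  have "inj_on ix (C - B)" using ix by (metis inj_onI)
  then have "inj_on \<sigma> {..<dim V}"
    unfolding \<sigma>_def using e by (intro comp_inj_on) (auto simp: bij_betw_def)
  moreover have "x = 0" if x: "x \<in> V" "\<forall>k<dim V. x $ \<sigma> k = 0" for x
  proof -
    have "orthogonal x c" if c: "c \<in> C" for c
    proof (cases "c \<in> B")
      case True
      then show ?thesis using B(1) x(1) by (auto simp: W_def)
    next
      case False
      then have "c \<in> e ` {..<dim V}" using c e by (simp add: bij_betw_def)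
      then obtain k where k: "k < dim V" "e k = c" by auto
      then have "c = axis (\<sigma> k) 1" using ix[of c] c False by (simp add: \<sigma>_def)
      then show ?thesis
        using x(2) k(1) by (simp add: orthogonal_def inner_axis)
    qed
    then have "orthogonal x y" if "y \<in> span C" for y
      using orthogonal_to_span[OF that] by blast
    then show "x = 0" using \<open>span C = UNIV\<close> orthogonal_self by blast
  qed
  ultimately show ?thesis by blast
qed

text \<open>For every \<open>t\<close> the scaled hull lies in a translate of the same subspace, the direction of the affine
hull of the velocities, whose dimension is \<open>R\<close>; so one projection serves all \<open>t\<close> at once.\<close>

lemma coordinate_projection_injective_on_hull:
  fixes v :: "nat \<Rightarrow> real ^ 'd"
  assumes R: "int R = aff_dim (convex hull (v ` I))"
  shows "\<exists>pr. coordinate_projection R pr \<and>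
    (\<forall>t. inj_on pr (convex hull ((\<lambda>i. t *\<^sub>R v i) ` I)))"
proof -
  have "I \<noteq> {}" using R by auto
  then obtain a where a: "a \<in> I" by blast
  define V where "V = span ((\<lambda>x. x - v a) ` v ` I)"
  have "v a \<in> affine hull (v ` I)" using a by (intro hull_inc) auto
  then have dimV: "dim V = R"
    using aff_dim_eq_dim_subtract[of "v a" "v ` I"] R by (simp add: V_def aff_dim_convex_hull)
  obtain \<sigma> :: "nat \<Rightarrow> 'd" where \<sigma>: "inj_on \<sigma> {..<R}"
      "\<And>x. x \<in> V \<Longrightarrow> (\<And>k. k < R \<Longrightarrow> x $ \<sigma> k = 0) \<Longrightarrow> x = 0"
    using coordinates_injective_on_subspace[of V] dimV unfolding V_def by auto
  define pr where "pr = (\<lambda>x :: real ^ 'd. \<lambda>k\<in>{..<R}. x $ \<sigma> k)"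
  have "inj_on pr (convex hull ((\<lambda>i. t *\<^sub>R v i) ` I))" for t
  proof (rule inj_onI)
    fix x y
    assume xy: "x \<in> convex hull ((\<lambda>i. t *\<^sub>R v i) ` I)" "y \<in> convex hull ((\<lambda>i. t *\<^sub>R v i) ` I)"
      and eq: "pr x = pr y"
    have "convex hull ((\<lambda>i. t *\<^sub>R v i) ` I) \<subseteq> (\<lambda>z. t *\<^sub>R v a + z) ` V"
    proof (rule hull_minimal)
      show "convex ((+) (t *\<^sub>R v a) ` V)"
        unfolding V_def by (intro convex_translation subspace_imp_convex subspace_span)
      show "(\<lambda>i. t *\<^sub>R v i) ` I \<subseteq> (+) (t *\<^sub>R v a) ` V"
      proof clarify
        fix i assume "i \<in> I"
        then have "t *\<^sub>R (v i - v a) \<in> V"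
          unfolding V_def by (intro span_scale span_base) auto
        then show "t *\<^sub>R v i \<in> (+) (t *\<^sub>R v a) ` V"
          by (intro image_eqI[of _ _ "t *\<^sub>R (v i - v a)"]) (auto simp: algebra_simps)
      qed
    qed
    then obtain x' y' where "x = t *\<^sub>R v a + x'" "y = t *\<^sub>R v a + y'" "x' \<in> V" "y' \<in> V"
      using xy by blast
    then have "x - y \<in> V" unfolding V_def by (simp add: span_diff)
    moreover have "(x - y) $ \<sigma> k = 0" if "k < R" for k
      using fun_cong[OF eq, of k] that by (simp add: pr_def)
    ultimately show "x = y" using \<sigma>(2)[of "x - y"] by simp
  qed
  moreover have "coordinate_projection R pr"
    using \<sigma>(1) by (auto simp: coordinate_projection_def pr_def)
  ultimately show ?thesis by blast
qed

section \<open>Finite-dimensional laws of a Poisson process\<close>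

context nonhom_poisson_process
begin

text \<open>Almost surely nothing happens at time \<open>0\<close>, and then prescribing the counts at the grid points is
the same as prescribing the independent increments.\<close>

lemma grid_probability:
  assumes \<tau>: "incseq \<tau>" "\<tau> 0 = 0"
    and k: "k 0 = 0" "\<And>i. i < m \<Longrightarrow> k i \<le> k (Suc i)"
  shows "\<P>(\<omega> in M. \<forall>i\<le>m. event_count T (\<tau> i) \<omega> = k i) =
    (\<Prod>i<m. exp (- integral {\<tau> i..\<tau> (Suc i)} rate) * integral {\<tau> i..\<tau> (Suc i)} rate ^ (k (Suc i) - k i)
       / fact (k (Suc i) - k i))"
proof -
  let ?N = "\<lambda>i \<omega>. event_count T (\<tau> i) \<omega>"
  let ?D = "\<lambda>i \<omega>. ?N (Suc i) \<omega> - ?N i \<omega>"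
  have \<tau>_pos: "0 \<le> \<tau> i" for i using incseqD[OF \<tau>(1), of 0 i] \<tau>(2) by simp
  have \<tau>_mono: "\<tau> i \<le> \<tau> (Suc i)" for i using \<tau>(1) by (simp add: incseq_SucD)
  have meas [measurable]: "?N i \<in> measurable M (count_space UNIV)" for i
    using \<tau>_pos event_count_measurable by blast
  have iff: "(\<forall>i\<le>m. ?N i \<omega> = k i) \<longleftrightarrow> (\<forall>i<m. ?D i \<omega> = k (Suc i) - k i)"
    if \<omega>: "\<omega> \<in> space M" "?N 0 \<omega> = 0" for \<omega>
  proof
    assume "\<forall>i\<le>m. ?N i \<omega> = k i"
    then show "\<forall>i<m. ?D i \<omega> = k (Suc i) - k i" by simp
  next
    assume D: "\<forall>i<m. ?D i \<omega> = k (Suc i) - k i"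
    have "?N i \<omega> = k i" if "i \<le> m" for i
      using that
    proof (induction i)
      case 0
      then show ?case using \<omega> k by simp
    next
      case (Suc i)
      have "?N i \<omega> \<le> ?N (Suc i) \<omega>" by (rule event_count_mono[OF \<omega>(1) \<tau>_pos \<tau>_mono])
      moreover have "?D i \<omega> = k (Suc i) - k i" using D Suc.prems by (metis Suc_le_lessD)
      ultimately show ?case using Suc k(2)[of i] by simp
    qed
    then show "\<forall>i\<le>m. ?N i \<omega> = k i" by blast
  qed
  have "prob {\<omega>\<in>space M. \<forall>i\<le>m. ?N i \<omega> = k i} = prob {\<omega>\<in>space M. \<forall>i<m. ?D i \<omega> = k (Suc i) - k i}"
  proof (rule finite_measure_eq_AE)
    show "AE \<omega> in M. \<omega> \<in> {\<omega>\<in>space M. \<forall>i\<le>m. ?N i \<omega> = k i} \<longleftrightarrow>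
        \<omega> \<in> {\<omega>\<in>space M. \<forall>i<m. ?D i \<omega> = k (Suc i) - k i}"
      using no_event_at_0 iff by (auto simp: \<tau>(2))
  qed measurable
  also have "\<dots> = (\<Prod>i<m. prob {\<omega>\<in>space M. ?D i \<omega> = k (Suc i) - k i})"
  proof (cases "m = 0")
    case True
    then show ?thesis by (simp add: prob_space)
  next
    case False
    have ind: "indep_vars (\<lambda>_. count_space UNIV) ?D {..<m}"
      by (rule independent_increments) (use \<tau> in auto)
    have "prob (\<Inter>i\<in>{..<m}. ?D i -` {k (Suc i) - k i} \<inter> space M)
        = (\<Prod>i<m. prob (?D i -` {k (Suc i) - k i} \<inter> space M))"
      by (rule indep_varsD_finite[OF ind]) (use False in auto)
    also have "(\<Inter>i\<in>{..<m}. ?D i -` {k (Suc i) - k i} \<inter> space M)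
        = {\<omega>\<in>space M. \<forall>i<m. ?D i \<omega> = k (Suc i) - k i}"
      using False by auto
    also have "(\<lambda>i. ?D i -` {k (Suc i) - k i} \<inter> space M) = (\<lambda>i. {\<omega>\<in>space M. ?D i \<omega> = k (Suc i) - k i})"
      by auto
    finally show ?thesis .
  qed
  also have "\<dots> = (\<Prod>i<m. exp (- integral {\<tau> i..\<tau> (Suc i)} rate) * integral {\<tau> i..\<tau> (Suc i)} rate ^ (k (Suc i) - k i)
       / fact (k (Suc i) - k i))"
    by (intro prod.cong refl poisson_increments \<tau>_pos \<tau>_mono)
  finally show ?thesis .
qed

lemma grid_probability_zero:
  assumes \<tau>: "incseq \<tau>" "\<tau> 0 = 0"
    and k: "\<not> (k 0 = 0 \<and> (\<forall>i<m. k i \<le> k (Suc i)))"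
  shows "\<P>(\<omega> in M. \<forall>i\<le>m. event_count T (\<tau> i) \<omega> = k i) = 0"
proof -
  have \<tau>_pos: "0 \<le> \<tau> i" for i using incseqD[OF \<tau>(1), of 0 i] \<tau>(2) by simp
  have [measurable]: "event_count T (\<tau> i) \<in> measurable M (count_space UNIV)" for i
    using \<tau>_pos event_count_measurable by blast
  have "AE \<omega> in M. \<not> (\<forall>i\<le>m. event_count T (\<tau> i) \<omega> = k i)"
    using no_event_at_0 AE_space
  proof eventually_elim
    case (elim \<omega>)
    show ?case
    proof
      assume *: "\<forall>i\<le>m. event_count T (\<tau> i) \<omega> = k i"
      then have "k 0 = 0" using elim(1) \<tau>(2) by auto
      moreover have "k i \<le> k (Suc i)" if "i < m" for i
        using event_count_mono[OF elim(2) \<tau>_pos[of i] incseq_SucD[OF \<tau>(1)]] * that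
        by (metis Suc_leI less_imp_le)
      ultimately show False using k by blast
    qed
  qed
  then show ?thesis by (subst prob_eq_0) measurable
qed

end

section \<open>Comparing the event times of two Poisson processes\<close>

text \<open>Two Poisson processes, possibly on different probability spaces, whose rates differ by the constant
factor \<open>\<alpha>\<close>.\<close>

locale poisson_pair =
  N: nonhom_poisson_process P T rate + N': nonhom_poisson_process P' T' "\<lambda>s. rate s * \<alpha>"
  for P :: "'w measure" and T :: "nat \<Rightarrow> 'w \<Rightarrow> ereal" and rate :: "real \<Rightarrow> real"
    and P' :: "'y measure" and T' :: "nat \<Rightarrow> 'y \<Rightarrow> ereal" and \<alpha> :: real +
  assumes rate_continuous: "continuous_on {0..} rate"
begin

text \<open>The likelihood ratio of the second process with respect to the first on \<open>[0,t]\<close>. That it depends on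
the path only through the number \<open>n\<close> of events is what makes the event times, given their number,
equally distributed for both processes.\<close>

definition density_ratio :: "real \<Rightarrow> nat \<Rightarrow> real" where
  "density_ratio t n = exp ((1 - \<alpha>) * integral {0..t} rate) * \<alpha> ^ n"

text \<open>In the product formula each interval contributes the factor \<open>exp ((1 - \<alpha>) * L) * \<alpha> ^ d\<close>, where \<open>L\<close>
is its mean and \<open>d\<close> the increment; the means add up to the integral of the rate and the increments
to the final count.\<close>

lemma grid_ratio:
  assumes \<tau>: "incseq \<tau>" "\<tau> 0 = 0"
  shows "\<P>(\<omega> in P'. \<forall>i\<le>m. event_count T' (\<tau> i) \<omega> = k i) =
    density_ratio (\<tau> m) (k m) * \<P>(\<omega> in P. \<forall>i\<le>m. event_count T (\<tau> i) \<omega> = k i)"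
proof (cases "k 0 = 0 \<and> (\<forall>i<m. k i \<le> k (Suc i))")
  case False
  then show ?thesis
    by (simp only: N.grid_probability_zero[OF \<tau> False] N'.grid_probability_zero[OF \<tau> False] mult_zero_right)
next
  case True
  then have k: "k 0 = 0" "\<And>i. i < m \<Longrightarrow> k i \<le> k (Suc i)" by auto
  define L where "L i = integral {\<tau> i..\<tau> (Suc i)} rate" for i
  define d where "d i = k (Suc i) - k i" for i
  have \<tau>_mono: "\<tau> i \<le> \<tau> (Suc i)" for i using \<tau>(1) by (simp add: incseq_SucD)
  have \<tau>_pos: "0 \<le> \<tau> i" for i using incseqD[OF \<tau>(1), of 0 i] \<tau>(2) by simp
  have sum_d: "j \<le> m \<Longrightarrow> (\<Sum>i<j. d i) = k j" for j
    by (induction j) (use k in \<open>auto simp: d_def\<close>)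
  have sum_L: "(\<Sum>i<j. L i) = integral {0..\<tau> j} rate" for j
  proof (induction j)
    case 0
    then show ?case by (simp add: \<tau>)
  next
    case (Suc j)
    have "rate integrable_on {0..\<tau> (Suc j)}"
      by (intro integrable_continuous_real continuous_on_subset[OF rate_continuous]) auto
    then have "integral {0..\<tau> j} rate + integral {\<tau> j..\<tau> (Suc j)} rate = integral {0..\<tau> (Suc j)} rate"
      using Henstock_Kurzweil_Integration.integral_combine[OF \<tau>_pos[of j] \<tau>_mono[of j]] by blast
    then show ?case using Suc by (simp add: L_def)
  qed
  have "\<P>(\<omega> in P'. \<forall>i\<le>m. event_count T' (\<tau> i) \<omega> = k i)
      = (\<Prod>i<m. exp (- (L i * \<alpha>)) * (L i * \<alpha>) ^ d i / fact (d i))"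
    using N'.grid_probability[OF \<tau> k] by (simp add: L_def d_def)
  also have "\<dots> = (\<Prod>i<m. exp ((1 - \<alpha>) * L i) * \<alpha> ^ d i * (exp (- L i) * L i ^ d i / fact (d i)))"
    by (intro prod.cong refl) (simp add: power_mult_distrib algebra_simps flip: exp_add)
  also have "\<dots> = (\<Prod>i<m. exp ((1 - \<alpha>) * L i)) * (\<Prod>i<m. \<alpha> ^ d i)
      * (\<Prod>i<m. exp (- L i) * L i ^ d i / fact (d i))"
    by (simp only: prod.distrib)
  also have "(\<Prod>i<m. exp ((1 - \<alpha>) * L i)) = exp ((1 - \<alpha>) * integral {0..\<tau> m} rate)"
    by (simp add: sum_distrib_left flip: exp_sum sum_L)
  also have "(\<Prod>i<m. \<alpha> ^ d i) = \<alpha> ^ k m"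
    using sum_d[of m] by (simp flip: power_sum)
  also have "(\<Prod>i<m. exp (- L i) * L i ^ d i / fact (d i)) = \<P>(\<omega> in P. \<forall>i\<le>m. event_count T (\<tau> i) \<omega> = k i)"
    using N.grid_probability[OF \<tau> k] by (simp add: L_def d_def)
  finally show ?thesis by (simp add: density_ratio_def)
qed

text \<open>Bounds on event times are statements about the counts at these bounds. On the grid formed by \<open>0\<close>,
\<open>t\<close> and all the bounds, the event splits into finitely many events prescribing every count.\<close>

lemma event_times_ratio:
  assumes K: "finite K" and r: "\<And>j. j \<in> K \<Longrightarrow> 0 \<le> r j \<and> r j \<le> t" and t: "0 \<le> t"
  shows "\<P>(\<omega> in P'. event_count T' t \<omega> = n \<and> (\<forall>j\<in>K. T' j \<omega> \<le> ereal (r j))) =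
    density_ratio t n * \<P>(\<omega> in P. event_count T t \<omega> = n \<and> (\<forall>j\<in>K. T j \<omega> \<le> ereal (r j)))"
proof -
  define L where "L = sorted_list_of_set (insert 0 (insert t (r ` K)))"
  define m where "m = length L - 1"
  \<comment> \<open>The independence of increments is stated for infinite grids, so the last point \<open>t\<close> is repeated.\<close>
  define \<tau> where "\<tau> i = L ! min i m" for i
  have set_L: "set L = insert 0 (insert t (r ` K))" 
    unfolding L_def by (rule set_sorted_list_of_set) (use K in simp)
  have L: "L \<noteq> []" "sorted L" using set_L by auto (simp add: L_def)
  have index: "min i m < length L" for i using L(1) by (cases L) (auto simp: m_def)
  have \<tau>_in: "\<tau> i \<in> set L" for i unfolding \<tau>_def using index by (rule nth_mem)
  have inc: "incseq \<tau>"
    unfolding incseq_def \<tau>_def using L(2) index by (intro allI impI sorted_nth_mono) auto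
  have ex: "\<exists>i\<le>m. \<tau> i = x" if x: "x \<in> set L" for x
  proof -
    obtain i where i: "i < length L" "L ! i = x" using x by (auto simp: in_set_conv_nth)
    then show ?thesis by (intro exI[of _ i]) (auto simp: \<tau>_def m_def min_def)
  qed
  have \<tau>_range: "0 \<le> \<tau> i \<and> \<tau> i \<le> t" for i using \<tau>_in[of i] r t unfolding set_L by auto
  obtain i0 where "\<tau> i0 = 0" using ex[of 0] set_L by auto
  then have \<tau>0: "\<tau> 0 = 0" using incseqD[OF inc, of 0 i0] \<tau>_range[of 0] by simp
  obtain it where "it \<le> m" "\<tau> it = t" using ex[of t] set_L by auto
  then have \<tau>m: "\<tau> m = t" using incseqD[OF inc, of it m] \<tau>_range[of m] by simp
  have "\<forall>j\<in>K. \<exists>i. i \<le> m \<and> \<tau> i = r j" using ex set_L by simp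
  then obtain idx where idx: "\<And>j. j \<in> K \<Longrightarrow> idx j \<le> m \<and> \<tau> (idx j) = r j" by metis
  define F where "F = {k \<in> {..m} \<rightarrow>\<^sub>E {..n}. k m = n \<and> (\<forall>j\<in>K. j \<le> k (idx j))}"
  have F: "finite F" unfolding F_def by (rule finite_subset[of _ "{..m} \<rightarrow>\<^sub>E {..n}"]) (auto intro: finite_PiE)
  have split: "\<P>(\<omega> in Q. event_count S t \<omega> = n \<and> (\<forall>j\<in>K. S j \<omega> \<le> ereal (r j)))
      = (\<Sum>k\<in>F. \<P>(\<omega> in Q. \<forall>i\<le>m. event_count S (\<tau> i) \<omega> = k i))"
    if "point_process Q S" for Q :: "'z measure" and S
  proof -
    interpret point_process Q S by fact
    have [measurable]: "event_count S (\<tau> i) \<in> measurable Q (count_space UNIV)" for i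
      using \<tau>_range event_count_measurable by blast
    have "{\<omega>\<in>space Q. event_count S t \<omega> = n \<and> (\<forall>j\<in>K. S j \<omega> \<le> ereal (r j))}
        = (\<Union>k\<in>F. {\<omega>\<in>space Q. \<forall>i\<le>m. event_count S (\<tau> i) \<omega> = k i})" (is "?l = ?r")
    proof (intro equalityI subsetI)
      fix \<omega> assume "\<omega> \<in> ?l"
      then have \<omega>: "\<omega> \<in> space Q" "event_count S t \<omega> = n" "\<And>j. j \<in> K \<Longrightarrow> j \<le> event_count S (r j) \<omega>"
        using r le_event_count_iff by auto
      have "(\<lambda>i\<in>{..m}. event_count S (\<tau> i) \<omega>) \<in> F"
        unfolding F_def
      proof (intro CollectI conjI ballI)
        show "(\<lambda>i\<in>{..m}. event_count S (\<tau> i) \<omega>) \<in> {..m} \<rightarrow>\<^sub>E {..n}"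
          using event_count_mono[OF \<omega>(1), of "\<tau> _" t] \<tau>_range \<omega>(2) by auto
        show "(\<lambda>i\<in>{..m}. event_count S (\<tau> i) \<omega>) m = n" using \<omega>(2) \<tau>m by simp
        show "j \<le> (\<lambda>i\<in>{..m}. event_count S (\<tau> i) \<omega>) (idx j)" if "j \<in> K" for j
          using idx[OF that] \<omega>(3)[OF that] by simp
      qed
      then show "\<omega> \<in> ?r" using \<omega>(1) by (intro UN_I) auto
    next
      fix \<omega> assume "\<omega> \<in> ?r"
      then obtain k where k: "k \<in> F" "\<omega> \<in> space Q" "\<And>i. i \<le> m \<Longrightarrow> event_count S (\<tau> i) \<omega> = k i" by auto
      have "S j \<omega> \<le> ereal (r j)" if j: "j \<in> K" for j
      proof -
        have "j \<le> k (idx j)" using k(1) j by (simp add: F_def)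
        then have "j \<le> event_count S (r j) \<omega>" using k(3)[of "idx j"] idx[OF j] by simp
        then show ?thesis using le_event_count_iff[OF k(2)] r[OF j] by blast
      qed
      then show "\<omega> \<in> ?l" using k k(3)[of m] by (auto simp: F_def \<tau>m)
    qed
    also have "measure Q \<dots> = (\<Sum>k\<in>F. \<P>(\<omega> in Q. \<forall>i\<le>m. event_count S (\<tau> i) \<omega> = k i))"
    proof (rule finite_measure_finite_Union[OF F])
      show "disjoint_family_on (\<lambda>k. {\<omega>\<in>space Q. \<forall>i\<le>m. event_count S (\<tau> i) \<omega> = k i}) F"
        unfolding disjoint_family_on_def
      proof (intro ballI impI, rule ccontr)
        fix k k' assume kk: "k \<in> F" "k' \<in> F" "k \<noteq> k'"
          "{\<omega>\<in>space Q. \<forall>i\<le>m. event_count S (\<tau> i) \<omega> = k i} \<inter>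
           {\<omega>\<in>space Q. \<forall>i\<le>m. event_count S (\<tau> i) \<omega> = k' i} \<noteq> {}"
        then obtain \<omega> where "\<forall>i\<le>m. event_count S (\<tau> i) \<omega> = k i" "\<forall>i\<le>m. event_count S (\<tau> i) \<omega> = k' i"
          by blast
        then have "k i = k' i" if "i \<in> {..m}" for i using that by simp
        moreover have "k \<in> {..m} \<rightarrow>\<^sub>E {..n}" "k' \<in> {..m} \<rightarrow>\<^sub>E {..n}"
          using kk(1,2) by (auto simp only: F_def mem_Collect_eq)
        ultimately have "k = k'" by (intro PiE_ext)
        then show False using kk by blast
      qed
    qed auto
    finally show ?thesis .
  qed
  have "\<P>(\<omega> in P'. \<forall>i\<le>m. event_count T' (\<tau> i) \<omega> = k i) =
    density_ratio t n * \<P>(\<omega> in P. \<forall>i\<le>m. event_count T (\<tau> i) \<omega> = k i)" if "k \<in> F" for k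
    using grid_ratio[OF inc \<tau>0, of m k] that by (simp add: F_def \<tau>m)
  then show ?thesis
    using split[OF N.point_process_axioms] split[OF N'.point_process_axioms]
    by (simp add: sum_distrib_left)
qed

end

text \<open>Joint laws of finitely many real random variables are thus determined by joint distribution
functions.\<close>

lemma sets_PiM_real_eq_orthants:
  assumes "finite I"
  shows "sets (Pi\<^sub>M I (\<lambda>_. borel :: real measure)) =
    sigma_sets (\<Pi>\<^sub>E i\<in>I. UNIV) {{f \<in> \<Pi>\<^sub>E i\<in>I. UNIV. \<forall>i\<in>I. f i \<le> s i} | s. True}"
proof -
  let ?E = "\<lambda>i. range (\<lambda>a::real. {..a})"
  have cover: "\<exists>S\<subseteq>range (\<lambda>a::real. {..a}). countable S \<and> UNIV = \<Union>S"
  proof (intro exI conjI)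
    show "UNIV = \<Union>(range (\<lambda>n. {..real n}))"
      using real_arch_simple by auto
  qed auto
  have "sets (Pi\<^sub>M I (\<lambda>_. borel :: real measure)) = sets (Pi\<^sub>M I (\<lambda>i. sigma UNIV (?E i)))"
    by (simp add: borel_eq_atMost)
  also have "\<dots> = sets (sigma (\<Pi>\<^sub>E i\<in>I. UNIV)
      {{f\<in>(\<Pi>\<^sub>E i\<in>I. UNIV). \<forall>i\<in>j. f i \<in> A i} | A j. j \<in> {I} \<and> A \<in> Pi j ?E})"
    by (rule sets_PiM_sigma) (use assms cover in auto)
  also have "{{f\<in>(\<Pi>\<^sub>E i\<in>I. UNIV). \<forall>i\<in>j. f i \<in> A i} | A j. j \<in> {I} \<and> A \<in> Pi j ?E}
      = {{f \<in> \<Pi>\<^sub>E i\<in>I. UNIV. \<forall>i\<in>I. f i \<le> s i} | s. True}" (is "?l = ?r")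
  proof (intro equalityI subsetI)
    fix X assume "X \<in> ?l"
    then obtain A where A: "X = {f\<in>(\<Pi>\<^sub>E i\<in>I. UNIV). \<forall>i\<in>I. f i \<in> A i}" "A \<in> Pi I ?E"
      by auto
    from A(2) have "\<forall>i\<in>I. \<exists>a. A i = {..a}" by auto
    then obtain s where "\<forall>i\<in>I. A i = {..s i}" by metis
    then have "X = {f \<in> \<Pi>\<^sub>E i\<in>I. UNIV. \<forall>i\<in>I. f i \<le> s i}" using A(1) by auto
    then show "X \<in> ?r" by blast
  next
    fix X assume "X \<in> ?r"
    then obtain s where "X = {f \<in> \<Pi>\<^sub>E i\<in>I. UNIV. \<forall>i\<in>I. f i \<in> {..s i}}" by auto
    then show "X \<in> ?l"
      by (intro CollectI exI[of _ "\<lambda>i. {..s i}"] exI[of _ I]) auto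
  qed
  also have "sets (sigma (\<Pi>\<^sub>E i\<in>I. UNIV) \<dots>) = sigma_sets (\<Pi>\<^sub>E i\<in>I. UNIV) \<dots>"
    by (rule sets_measure_of) auto
  finally show ?thesis .
qed

context point_process
begin

lemma clipped_times_measurable:
  "(\<lambda>\<omega>. \<lambda>j\<in>{..m}. clip t (T j \<omega>)) \<in> measurable M (Pi\<^sub>M {..m} (\<lambda>_. borel))"
proof -
  note event_time_measurable[measurable]
  show ?thesis by measurable
qed

end

context poisson_pair
begin

text \<open>A clipped time always lies in \<open>[0,t]\<close>: a negative bound makes the event empty, and a bound of at
least \<open>t\<close> is no restriction. Only the remaining bounds concern genuine event times.\<close>

lemma orthant_ratio:
  assumes t: "0 \<le> t"
  shows "\<P>(\<omega> in P'. event_count T' t \<omega> = n \<and> (\<forall>j\<le>m. clip t (T' j \<omega>) \<le> s j)) =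
    density_ratio t n * \<P>(\<omega> in P. event_count T t \<omega> = n \<and> (\<forall>j\<le>m. clip t (T j \<omega>) \<le> s j))"
proof (cases "\<exists>j\<le>m. s j < 0")
  case True
  then obtain j where j: "j \<le> m" "s j < 0" by blast
  have empty: "{\<omega>\<in>space Q. event_count S t \<omega> = n \<and> (\<forall>j\<le>m. clip t (S j \<omega>) \<le> s j)} = {}"
    if "point_process Q S" for Q :: "'z measure" and S
  proof -
    interpret point_process Q S by fact
    have "\<not> clip t (S j \<omega>) \<le> s j" if "\<omega> \<in> space Q" for \<omega>
      using clip_bounds(1)[OF event_time_nonneg[OF that] t, of j] j(2) by linarith
    then show ?thesis using j(1) by auto
  qed
  show ?thesis
    by (simp only: empty[OF N.point_process_axioms] empty[OF N'.point_process_axioms]) simp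
next
  case False
  define K where "K = {j. j \<le> m \<and> s j < t}"
  have eq: "{\<omega>\<in>space Q. event_count S t \<omega> = n \<and> (\<forall>j\<le>m. clip t (S j \<omega>) \<le> s j)}
      = {\<omega>\<in>space Q. event_count S t \<omega> = n \<and> (\<forall>j\<in>K. S j \<omega> \<le> ereal (s j))}"
    if "point_process Q S" for Q :: "'z measure" and S
  proof -
    interpret point_process Q S by fact
    have "(\<forall>j\<le>m. clip t (S j \<omega>) \<le> s j) \<longleftrightarrow> (\<forall>j\<in>K. S j \<omega> \<le> ereal (s j))"
      if \<omega>: "\<omega> \<in> space Q" for \<omega>
    proof -
      have "clip t (S j \<omega>) \<le> s j \<longleftrightarrow> (j \<in> K \<longrightarrow> S j \<omega> \<le> ereal (s j))" if j: "j \<le> m" for j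
      proof (cases "j \<in> K")
        case True
        then show ?thesis
          using clip_le_iff[OF event_time_nonneg[OF \<omega>], of "s j" t j] False j by (auto simp: K_def)
      next
        case out: False
        then show ?thesis
          using clip_bounds(2)[OF event_time_nonneg[OF \<omega>] t, of j] j by (auto simp: K_def)
      qed
      then show ?thesis by (auto simp: K_def)
    qed
    then show ?thesis by auto
  qed
  have "finite K" by (simp add: K_def)
  moreover have "0 \<le> s j \<and> s j \<le> t" if "j \<in> K" for j using that False by (auto simp: K_def not_less)
  ultimately show ?thesis
    unfolding eq[OF N.point_process_axioms] eq[OF N'.point_process_axioms]
    using event_times_ratio t by blast
qed

text \<open>The events with the stated proportion form a Dynkin system, which contains the orthants by
\<open>orthant_ratio\<close>.\<close>

lemma clipped_times_ratio:
  assumes t: "0 \<le> t" and B: "B \<in> sets (Pi\<^sub>M {..m} (\<lambda>_. borel))"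
  shows "\<P>(\<omega> in P'. event_count T' t \<omega> = n \<and> (\<lambda>j\<in>{..m}. clip t (T' j \<omega>)) \<in> B) =
    density_ratio t n * \<P>(\<omega> in P. event_count T t \<omega> = n \<and> (\<lambda>j\<in>{..m}. clip t (T j \<omega>)) \<in> B)"
proof -
  let ?\<Omega> = "\<Pi>\<^sub>E i\<in>{..m}. (UNIV :: real set)"
  let ?G = "{{f \<in> ?\<Omega>. \<forall>i\<in>{..m}. f i \<le> s i} | s. True}"
  have gen: "sets (Pi\<^sub>M {..m} (\<lambda>_. borel)) = sigma_sets ?\<Omega> ?G"
    by (rule sets_PiM_real_eq_orthants) simp
  define E where "E = (\<lambda>B. {\<omega>\<in>space P. event_count T t \<omega> = n \<and> (\<lambda>j\<in>{..m}. clip t (T j \<omega>)) \<in> B})"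
  define E' where "E' = (\<lambda>B. {\<omega>\<in>space P'. event_count T' t \<omega> = n \<and> (\<lambda>j\<in>{..m}. clip t (T' j \<omega>)) \<in> B})"
  note [measurable] = N.clipped_times_measurable N'.clipped_times_measurable
    N.event_count_measurable[OF t] N'.event_count_measurable[OF t]
  have E_sets: "E B \<in> sets P" "E' B \<in> sets P'" if "B \<in> sigma_sets ?\<Omega> ?G" for B
  proof -
    have [measurable]: "B \<in> sets (Pi\<^sub>M {..m} (\<lambda>_. borel))" using that gen by blast
    show "E B \<in> sets P" "E' B \<in> sets P'" unfolding E_def E'_def by measurable
  qed
  have diff: "E (?\<Omega> - B) = E ?\<Omega> - E B" "E' (?\<Omega> - B) = E' ?\<Omega> - E' B"
    and sub: "E B \<subseteq> E ?\<Omega>" "E' B \<subseteq> E' ?\<Omega>" for B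
    by (auto simp: E_def E'_def)
  have orthant: "measure P' (E' X) = density_ratio t n * measure P (E X)" if "X \<in> ?G" for X
  proof -
    obtain s where "X = {f \<in> ?\<Omega>. \<forall>i\<in>{..m}. f i \<le> s i}" using \<open>X \<in> ?G\<close> by blast
    then have "E X = {\<omega>\<in>space P. event_count T t \<omega> = n \<and> (\<forall>j\<le>m. clip t (T j \<omega>) \<le> s j)}"
      "E' X = {\<omega>\<in>space P'. event_count T' t \<omega> = n \<and> (\<forall>j\<le>m. clip t (T' j \<omega>) \<le> s j)}"
      by (auto simp: E_def E'_def)
    then show ?thesis using orthant_ratio[OF t] by simp
  qed
  have whole: "measure P' (E' ?\<Omega>) = density_ratio t n * measure P (E ?\<Omega>)"
  proof -
    have "E ?\<Omega> = {\<omega>\<in>space P. event_count T t \<omega> = n \<and> (\<forall>j\<in>{}. T j \<omega> \<le> ereal t)}"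
      "E' ?\<Omega> = {\<omega>\<in>space P'. event_count T' t \<omega> = n \<and> (\<forall>j\<in>{}. T' j \<omega> \<le> ereal t)}"
      by (auto simp: E_def E'_def)
    then show ?thesis using event_times_ratio[of "{}" "\<lambda>_. t" t n] t by simp
  qed
  have stable: "Int_stable ?G"
  proof (rule Int_stableI)
    fix X Y assume "X \<in> ?G" "Y \<in> ?G"
    then obtain r s where "X = {f \<in> ?\<Omega>. \<forall>i\<in>{..m}. f i \<le> r i}" "Y = {f \<in> ?\<Omega>. \<forall>i\<in>{..m}. f i \<le> s i}"
      by blast
    then have "X \<inter> Y = {f \<in> ?\<Omega>. \<forall>i\<in>{..m}. f i \<le> min (r i) (s i)}" by auto
    then show "X \<inter> Y \<in> ?G" by (intro CollectI exI[of _ "\<lambda>i. min (r i) (s i)"]) simp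
  qed
  have closed: "?G \<subseteq> Pow ?\<Omega>" by auto
  have B': "B \<in> sigma_sets ?\<Omega> ?G" using B gen by simp
  have "measure P' (E' B) = density_ratio t n * measure P (E B)"
    using stable closed B'
  proof (induction rule: sigma_sets_induct_disjoint)
    case (basic X)
    then show ?case by (rule orthant)
  next
    case empty
    then show ?case by (simp add: E_def E'_def)
  next
    case (compl X)
    have top: "?\<Omega> \<in> sigma_sets ?\<Omega> ?G" by (rule sigma_sets_top)
    have "measure P' (E' (?\<Omega> - X)) = measure P' (E' ?\<Omega>) - measure P' (E' X)"
      unfolding diff by (intro N'.finite_measure_Diff E_sets top compl sub)
    moreover have "measure P (E (?\<Omega> - X)) = measure P (E ?\<Omega>) - measure P (E X)"
      unfolding diff by (intro N.finite_measure_Diff E_sets top compl sub)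
    ultimately show ?case using compl(2) whole by (simp add: right_diff_distrib)
  next
    case (union X)
    have U: "E (\<Union>i. X i) = (\<Union>i. E (X i))" "E' (\<Union>i. X i) = (\<Union>i. E' (X i))"
      by (auto simp: E_def E'_def)
    have dis: "disjoint_family (\<lambda>i. E (X i))" "disjoint_family (\<lambda>i. E' (X i))"
      using union(1) unfolding disjoint_family_on_def E_def E'_def by blast+
    have "(\<lambda>i. measure P (E (X i))) sums measure P (E (\<Union>i. X i))"
      unfolding U by (rule N.finite_measure_UNION) (use union(2) E_sets dis in auto)
    then have "(\<lambda>i. measure P' (E' (X i))) sums (density_ratio t n * measure P (E (\<Union>i. X i)))"
      unfolding union(3) by (rule sums_mult)
    moreover have "(\<lambda>i. measure P' (E' (X i))) sums measure P' (E' (\<Union>i. X i))"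
      unfolding U by (rule N'.finite_measure_UNION) (use union(2) E_sets dis in auto)
    ultimately show ?case by (rule sums_unique2[THEN sym])
  qed
  then show ?thesis by (simp add: E_def E'_def)
qed

text \<open>On the event of exactly \<open>n\<close> changes along a fixed sequence \<open>a\<close> of indices, the end point is a Borel
function of \<open>n + 2\<close> clipped event times.\<close>

lemma endpoint_ratio:
  fixes v :: "nat \<Rightarrow> 'v::euclidean_space"
  assumes t: "0 \<le> t" and A [measurable]: "A \<in> sets borel"
  shows "\<P>(\<omega> in P'. event_count T' t \<omega> = n \<and> endpoint v a (\<lambda>l. clip t (T' l \<omega>)) n \<in> A) =
    density_ratio t n * \<P>(\<omega> in P. event_count T t \<omega> = n \<and> endpoint v a (\<lambda>l. clip t (T l \<omega>)) n \<in> A)"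
proof -
  let ?B = "{u \<in> space (Pi\<^sub>M {..Suc n} (\<lambda>_. borel :: real measure)). endpoint v a u n \<in> A}"
  have [measurable]: "(\<lambda>u. endpoint v a u n) \<in> borel_measurable (Pi\<^sub>M {..Suc n} (\<lambda>_. borel))"
    unfolding endpoint_def by measurable
  have B: "?B \<in> sets (Pi\<^sub>M {..Suc n} (\<lambda>_. borel))" by measurable
  have iff: "(\<lambda>j\<in>{..Suc n}. u j) \<in> ?B \<longleftrightarrow> endpoint v a u n \<in> A" for u
    by (simp add: space_PiM endpoint_def)
  show ?thesis using clipped_times_ratio[OF t B, of n] by (simp only: iff)
qed

end

section \<open>The law of the motion as a sum over paths\<close>

context velocity_driver
begin

lemma endpoint_path_independent:
  fixes v :: "nat \<Rightarrow> 'v::euclidean_space"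
  assumes t: "0 \<le> t" and A [measurable]: "A \<in> sets borel"
  shows "\<P>(\<omega> in M. (event_count T t \<omega> = n \<and> endpoint v a (\<lambda>l. clip t (T l \<omega>)) n \<in> A) \<and>
      (\<forall>k\<le>n. J k \<omega> = a k)) =
    \<P>(\<omega> in M. event_count T t \<omega> = n \<and> endpoint v a (\<lambda>l. clip t (T l \<omega>)) n \<in> A) *
    \<P>(\<omega> in M. \<forall>k\<le>n. J k \<omega> = a k)"
proof -
  \<comment> \<open>The two independent sequences take values in one type, so indices appear as extended reals.\<close>
  let ?X = "{x \<in> space (Pi\<^sub>M UNIV (\<lambda>_::nat. borel :: ereal measure)).
    (x n \<le> ereal t \<and> \<not> x (Suc n) \<le> ereal t) \<and> endpoint v a (\<lambda>l. clip t (x l)) n \<in> A}"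
  let ?Y = "{y \<in> space (Pi\<^sub>M UNIV (\<lambda>_::nat. count_space (UNIV :: ereal set))). \<forall>k\<le>n. y k = ereal (real (a k))}"
  have [measurable]: "(\<lambda>x. endpoint v a (\<lambda>l. clip t (x l)) n) \<in> borel_measurable (Pi\<^sub>M UNIV (\<lambda>_. borel))"
    unfolding endpoint_def by measurable
  have X: "?X \<in> sets (Pi\<^sub>M UNIV (\<lambda>_. borel))" by measurable
  have Y: "?Y \<in> sets (Pi\<^sub>M UNIV (\<lambda>_. count_space UNIV))" by measurable
  have "(\<lambda>\<omega> n. T n \<omega>) -` ?X \<inter> space M
      = {\<omega>\<in>space M. event_count T t \<omega> = n \<and> endpoint v a (\<lambda>l. clip t (T l \<omega>)) n \<in> A}"
    using event_count_eq_iff[OF _ t] by (auto simp: space_PiM)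
  moreover have "(\<lambda>\<omega> n. ereal (real (J n \<omega>))) -` ?Y \<inter> space M = {\<omega>\<in>space M. \<forall>k\<le>n. J k \<omega> = a k}"
    by (auto simp: space_PiM)
  moreover have "(\<lambda>\<omega>. (\<lambda>n. T n \<omega>, \<lambda>n. ereal (real (J n \<omega>)))) -` (?X \<times> ?Y) \<inter> space M
      = ((\<lambda>\<omega> n. T n \<omega>) -` ?X \<inter> space M) \<inter> ((\<lambda>\<omega> n. ereal (real (J n \<omega>))) -` ?Y \<inter> space M)"
    by blast
  moreover have "{\<omega>\<in>space M. event_count T t \<omega> = n \<and> endpoint v a (\<lambda>l. clip t (T l \<omega>)) n \<in> A}
      \<inter> {\<omega>\<in>space M. \<forall>k\<le>n. J k \<omega> = a k}
      = {\<omega>\<in>space M. (event_count T t \<omega> = n \<and> endpoint v a (\<lambda>l. clip t (T l \<omega>)) n \<in> A) \<and>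
        (\<forall>k\<le>n. J k \<omega> = a k)}"
    by blast
  ultimately show ?thesis using indep_varD[OF chain_independent X Y] by simp
qed

lemma motion_eq_endpoint:
  "\<omega> \<in> space M \<Longrightarrow> 0 \<le> t \<Longrightarrow>
    motion v T J t \<omega> = endpoint v (\<lambda>l. J l \<omega>) (\<lambda>l. clip t (T l \<omega>)) (event_count T t \<omega>)"
  unfolding motion_def by (intro integral_unique velocity_has_integral)

text \<open>The motion is determined by the number of events, the sequence of indices up to it and the event
times. Summing over the first two and using independence reduces its law to the laws of end points
along fixed sequences of indices.\<close>

lemma motion_path_sums:
  fixes v :: "nat \<Rightarrow> real ^ 'd"
  assumes t: "0 \<le> t" and A [measurable]: "A \<in> sets borel" and K: "K \<subseteq> I"
  shows "(\<lambda>n. \<Sum>a\<in>{..n} \<rightarrow>\<^sub>E K.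
      \<P>(\<omega> in M. event_count T t \<omega> = n \<and> endpoint v a (\<lambda>l. clip t (T l \<omega>)) n \<in> A) *
      (p (a 0) * (\<Prod>k<n. q (a k) (a (Suc k)))))
    sums \<P>(\<omega> in M. motion v T J t \<omega> \<in> A \<and> (\<forall>l\<le>event_count T t \<omega>. J l \<omega> \<in> K))"
proof -
  let ?E = "\<lambda>n a. {\<omega>\<in>space M. (event_count T t \<omega> = n \<and> endpoint v a (\<lambda>l. clip t (T l \<omega>)) n \<in> A) \<and>
      (\<forall>k\<le>n. J k \<omega> = a k)}"
  note [measurable] = event_time_measurable chain_measurable event_count_measurable[OF t]
  have [measurable]: "(\<lambda>\<omega>. endpoint v a (\<lambda>l. clip t (T l \<omega>)) n) \<in> borel_measurable M" for a n
    unfolding endpoint_def by measurable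
  have E: "?E n a \<in> sets M" for n a by measurable
  have fin: "finite ({..n} \<rightarrow>\<^sub>E K)" for n :: nat
    using finite_subset[OF K finite_index] by (intro finite_PiE) auto
  have disj: "disjoint_family_on (?E n) ({..n} \<rightarrow>\<^sub>E K)" for n
    unfolding disjoint_family_on_def
  proof (intro ballI impI, rule ccontr)
    fix a b assume ab: "a \<in> {..n} \<rightarrow>\<^sub>E K" "b \<in> {..n} \<rightarrow>\<^sub>E K" "a \<noteq> b" "?E n a \<inter> ?E n b \<noteq> {}"
    then obtain \<omega> where "\<forall>k\<le>n. J k \<omega> = a k" "\<forall>k\<le>n. J k \<omega> = b k" by blast
    then have "a k = b k" if "k \<in> {..n}" for k using that by simp
    then have "a = b" using ab(1,2) by (intro PiE_ext)
    then show False using ab by blast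
  qed
  have prob_n: "measure M (\<Union>a\<in>{..n} \<rightarrow>\<^sub>E K. ?E n a) = (\<Sum>a\<in>{..n} \<rightarrow>\<^sub>E K.
      \<P>(\<omega> in M. event_count T t \<omega> = n \<and> endpoint v a (\<lambda>l. clip t (T l \<omega>)) n \<in> A) *
      (p (a 0) * (\<Prod>k<n. q (a k) (a (Suc k)))))" for n
  proof -
    have "measure M (\<Union>a\<in>{..n} \<rightarrow>\<^sub>E K. ?E n a) = (\<Sum>a\<in>{..n} \<rightarrow>\<^sub>E K. measure M (?E n a))"
      by (rule finite_measure_finite_Union[OF fin]) (use E disj in auto)
    also have "\<dots> = (\<Sum>a\<in>{..n} \<rightarrow>\<^sub>E K.
      \<P>(\<omega> in M. event_count T t \<omega> = n \<and> endpoint v a (\<lambda>l. clip t (T l \<omega>)) n \<in> A) *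
      (p (a 0) * (\<Prod>k<n. q (a k) (a (Suc k)))))"
    proof (rule sum.cong[OF refl])
      fix a assume "a \<in> {..n} \<rightarrow>\<^sub>E K"
      then have "a k \<in> I" if "k \<le> n" for k using that K by auto
      then show "measure M (?E n a) =
        \<P>(\<omega> in M. event_count T t \<omega> = n \<and> endpoint v a (\<lambda>l. clip t (T l \<omega>)) n \<in> A) *
        (p (a 0) * (\<Prod>k<n. q (a k) (a (Suc k))))"
        using endpoint_path_independent[OF t A] path_probability[of n a] by simp
    qed
    finally show ?thesis .
  qed
  have union: "{\<omega>\<in>space M. motion v T J t \<omega> \<in> A \<and> (\<forall>l\<le>event_count T t \<omega>. J l \<omega> \<in> K)}
      = (\<Union>n. \<Union>a\<in>{..n} \<rightarrow>\<^sub>E K. ?E n a)" (is "?l = ?r")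
  proof (intro equalityI subsetI)
    fix \<omega> assume \<omega>: "\<omega> \<in> ?l"
    define n where "n = event_count T t \<omega>"
    define a where "a = (\<lambda>k\<in>{..n}. J k \<omega>)"
    have "endpoint v a (\<lambda>l. clip t (T l \<omega>)) n = motion v T J t \<omega>"
      using \<omega> by (simp add: motion_eq_endpoint t endpoint_def a_def n_def)
    then have "\<omega> \<in> ?E n a" using \<omega> by (simp add: n_def) (simp add: a_def n_def)
    moreover have "a \<in> {..n} \<rightarrow>\<^sub>E K" using \<omega> by (auto simp: a_def n_def)
    ultimately show "\<omega> \<in> ?r" by blast
  next
    fix \<omega> assume "\<omega> \<in> ?r"
    then obtain n a where a: "a \<in> {..n} \<rightarrow>\<^sub>E K" "\<omega> \<in> ?E n a" by blast
    then have "motion v T J t \<omega> = endpoint v a (\<lambda>l. clip t (T l \<omega>)) n"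
      by (simp add: motion_eq_endpoint t endpoint_def)
    then show "\<omega> \<in> ?l" using a by auto
  qed
  have "(\<lambda>n. measure M (\<Union>a\<in>{..n} \<rightarrow>\<^sub>E K. ?E n a)) sums measure M (\<Union>n. \<Union>a\<in>{..n} \<rightarrow>\<^sub>E K. ?E n a)"
  proof (rule finite_measure_UNION)
    show "range (\<lambda>n. \<Union>a\<in>{..n} \<rightarrow>\<^sub>E K. ?E n a) \<subseteq> sets M"
      using E fin by (auto intro!: sets.finite_UN)
    show "disjoint_family (\<lambda>n. \<Union>a\<in>{..n} \<rightarrow>\<^sub>E K. ?E n a)"
      unfolding disjoint_family_on_def by auto
  qed
  then show ?thesis unfolding union prob_n .
qed

end

section \<open>Conditioning on a set of velocities\<close>

lemma displacement_count_zero_iff: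
  assumes "inj_on v {..M}" "I \<subseteq> {..M}" "\<And>l. J l \<omega> \<le> M"
  shows "(\<forall>j\<in>{..M} - I. displacement_count v T J j t \<omega> = 0) \<longleftrightarrow>
    (\<forall>l\<le>event_count T t \<omega>. J l \<omega> \<in> I)"
proof -
  have "displacement_count v T J j t \<omega> = 0 \<longleftrightarrow> (\<forall>l\<le>event_count T t \<omega>. J l \<omega> \<noteq> j)"
    if "j \<le> M" for j
  proof -
    have "{l. l \<le> event_count T t \<omega> \<and> v (J l \<omega>) = v j} = {l. l \<le> event_count T t \<omega> \<and> J l \<omega> = j}"
      using inj_onD[OF assms(1)] assms(3) that by auto
    then show ?thesis by (auto simp: displacement_count_def)
  qed
  then show ?thesis using assms(3) by auto
qed

text \<open>For each sequence of \<open>n + 1\<close> indices the factor \<open>\<alpha> ^ n\<close> gained by the \<open>n\<close> events is lost by the \<open>n\<close>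
transition probabilities. What is left of the ratio does not depend on the path, so it
can be taken out of the sum over all paths.\<close>

lemma restricted_motion_proportional:
  fixes v :: "nat \<Rightarrow> real ^ 'd" and q :: "nat \<Rightarrow> nat \<Rightarrow> real"
  assumes rate: "continuous_on {0..} rate"
    and driver: "velocity_driver P T rate J I\<^sub>0 p q"
    and driver': "velocity_driver P' T' (\<lambda>s. rate s * \<alpha>) J' I (\<lambda>i. p i / S) (\<lambda>i j. q i j / \<alpha>)"
    and I: "I \<subseteq> I\<^sub>0" and \<alpha>: "\<alpha> \<noteq> 0" and t: "0 \<le> t" and A: "A \<in> sets borel"
  shows "\<P>(\<omega> in P'. motion v T' J' t \<omega> \<in> A) =
    exp ((1 - \<alpha>) * integral {0..t} rate) / S *
    \<P>(\<omega> in P. motion v T J t \<omega> \<in> A \<and> (\<forall>l\<le>event_count T t \<omega>. J l \<omega> \<in> I))"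
proof -
  interpret X: velocity_driver P T rate J I\<^sub>0 p q by fact
  interpret Y: velocity_driver P' T' "\<lambda>s. rate s * \<alpha>" J' I "\<lambda>i. p i / S" "\<lambda>i j. q i j / \<alpha>" by fact
  interpret poisson_pair P T rate P' T' \<alpha> by unfold_locales (rule rate)
  let ?c = "exp ((1 - \<alpha>) * integral {0..t} rate) / S"
  let ?w = "\<lambda>n a. p (a 0) * (\<Prod>k<n. q (a k) (a (Suc k)))"
  let ?f = "\<lambda>n a. \<P>(\<omega> in P. event_count T t \<omega> = n \<and> endpoint v a (\<lambda>l. clip t (T l \<omega>)) n \<in> A)"
  let ?f' = "\<lambda>n a. \<P>(\<omega> in P'. event_count T' t \<omega> = n \<and> endpoint v a (\<lambda>l. clip t (T' l \<omega>)) n \<in> A)"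
  have term_ratio: "?f' n a * (p (a 0) / S * (\<Prod>k<n. q (a k) (a (Suc k)) / \<alpha>)) = ?c * (?f n a * ?w n a)" for n a
    unfolding endpoint_ratio[OF t A] density_ratio_def
    using \<alpha> by (simp add: prod_dividef)
  have "(\<lambda>n. \<Sum>a\<in>{..n} \<rightarrow>\<^sub>E I. ?f' n a * (p (a 0) / S * (\<Prod>k<n. q (a k) (a (Suc k)) / \<alpha>)))
      sums \<P>(\<omega> in P'. motion v T' J' t \<omega> \<in> A \<and> (\<forall>l\<le>event_count T' t \<omega>. J' l \<omega> \<in> I))"
    by (rule Y.motion_path_sums[OF t A]) simp
  then have "(\<lambda>n. ?c * (\<Sum>a\<in>{..n} \<rightarrow>\<^sub>E I. ?f n a * ?w n a))
      sums \<P>(\<omega> in P'. motion v T' J' t \<omega> \<in> A \<and> (\<forall>l\<le>event_count T' t \<omega>. J' l \<omega> \<in> I))"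
    by (simp only: term_ratio sum_distrib_left)
  moreover have "(\<lambda>n. ?c * (\<Sum>a\<in>{..n} \<rightarrow>\<^sub>E I. ?f n a * ?w n a))
      sums (?c * \<P>(\<omega> in P. motion v T J t \<omega> \<in> A \<and> (\<forall>l\<le>event_count T t \<omega>. J l \<omega> \<in> I)))"
    by (intro sums_mult X.motion_path_sums t A I)
  ultimately have "\<P>(\<omega> in P'. motion v T' J' t \<omega> \<in> A \<and> (\<forall>l\<le>event_count T' t \<omega>. J' l \<omega> \<in> I))
      = ?c * \<P>(\<omega> in P. motion v T J t \<omega> \<in> A \<and> (\<forall>l\<le>event_count T t \<omega>. J l \<omega> \<in> I))"
    by (rule sums_unique2)
  moreover have "{\<omega>\<in>space P'. motion v T' J' t \<omega> \<in> A \<and> (\<forall>l\<le>event_count T' t \<omega>. J' l \<omega> \<in> I)}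
      = {\<omega>\<in>space P'. motion v T' J' t \<omega> \<in> A}"
    using Y.chain_in by auto
  ultimately show ?thesis by simp
qed

text \<open>The constant of proportionality needs no computation: the law on \<open>P'\<close> has total mass \<open>1\<close>, so
\<open>A = UNIV\<close> shows that the constant is the inverse of the probability of the conditioning event, and in
particular that this probability is positive.\<close>

lemma conditioned_motion_law:
  fixes v :: "nat \<Rightarrow> real ^ 'd" and q :: "nat \<Rightarrow> nat \<Rightarrow> real"
  assumes rate: "continuous_on {0..} rate"
    and driver: "velocity_driver P T rate J I\<^sub>0 p q"
    and driver': "velocity_driver P' T' (\<lambda>s. rate s * \<alpha>) J' I (\<lambda>i. p i / S) (\<lambda>i j. q i j / \<alpha>)"
    and I: "I \<subseteq> I\<^sub>0" and \<alpha>: "\<alpha> \<noteq> 0" and t: "0 \<le> t" and A: "A \<in> sets borel"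
  shows "\<P>(\<omega> in P. motion v T J t \<omega> \<in> A \<bar> \<forall>l\<le>event_count T t \<omega>. J l \<omega> \<in> I) =
    \<P>(\<omega> in P'. motion v T' J' t \<omega> \<in> A)"
proof -
  interpret Y: velocity_driver P' T' "\<lambda>s. rate s * \<alpha>" J' I "\<lambda>i. p i / S" "\<lambda>i j. q i j / \<alpha>" by fact
  note proportional = restricted_motion_proportional[OF rate driver driver' I \<alpha> t, of _ v]
  define c where "c = exp ((1 - \<alpha>) * integral {0..t} rate) / S"
  have total: "1 = c * \<P>(\<omega> in P. \<forall>l\<le>event_count T t \<omega>. J l \<omega> \<in> I)"
    using proportional[of UNIV] by (auto simp: c_def Y.prob_space)
  then have "c \<noteq> 0" by auto
  then have "\<P>(\<omega> in P. \<forall>l\<le>event_count T t \<omega>. J l \<omega> \<in> I) = 1 / c"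
    using total by (simp add: field_simps)
  then show ?thesis using proportional[OF A] by (simp add: cond_prob_def c_def)
qed

text \<open>Path by path, \<open>motion_coords\<close> is the projection of the unprojected motion with the same driver, and
that motion stays in the convex hull, where the projection is injective.\<close>

lemma motion_coords_in_image_iff:
  fixes v :: "nat \<Rightarrow> real ^ 'd"
  assumes driver: "velocity_driver P T rate J I p q"
    and pr: "coordinate_projection R pr"
    and inj: "inj_on pr (convex hull ((\<lambda>i. t *\<^sub>R v i) ` I))"
    and A: "A \<subseteq> convex hull ((\<lambda>i. t *\<^sub>R v i) ` I)"
    and t: "0 \<le> t" and \<omega>: "\<omega> \<in> space P"
  shows "motion_coords R (\<lambda>i. pr (v i)) T J t \<omega> \<in> pr ` A \<longleftrightarrow> motion v T J t \<omega> \<in> A"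
proof -
  interpret velocity_driver P T rate J I p q by fact
  obtain \<sigma> :: "nat \<Rightarrow> 'd" where \<sigma>: "pr = (\<lambda>x. \<lambda>k\<in>{..<R}. x $ \<sigma> k)"
    using pr by (auto simp: coordinate_projection_def)
  let ?e = "\<lambda>w::nat \<Rightarrow> real. endpoint w (\<lambda>l. J l \<omega>) (\<lambda>l. clip t (T l \<omega>)) (event_count T t \<omega>)"
  have "motion_coords R (\<lambda>i. pr (v i)) T J t \<omega> = pr (motion v T J t \<omega>)"
  proof
    fix k
    show "motion_coords R (\<lambda>i. pr (v i)) T J t \<omega> k = pr (motion v T J t \<omega>) k"
    proof (cases "k < R")
      case True
      have "motion_coords R (\<lambda>i. pr (v i)) T J t \<omega> k
          = integral {0..t} (\<lambda>s. velocity (\<lambda>i. v i $ \<sigma> k) T J s \<omega>)"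
        using True by (simp add: motion_coords_def velocity_def \<sigma>)
      also have "\<dots> = ?e (\<lambda>i. v i $ \<sigma> k)"
        by (intro integral_unique velocity_has_integral \<omega> t)
      also have "\<dots> = pr (motion v T J t \<omega>) k"
        using True by (simp add: motion_eq_endpoint[OF \<omega> t] endpoint_def \<sigma>)
      finally show ?thesis .
    qed (simp add: motion_coords_def \<sigma>)
  qed
  moreover have "motion v T J t \<omega> \<in> convex hull ((\<lambda>i. t *\<^sub>R v i) ` I)"
    unfolding motion_eq_endpoint[OF \<omega> t]
    by (rule endpoint_in_convex_hull[OF \<omega> t]) (rule chain_in[OF \<omega>])
  ultimately show ?thesis using inj_on_image_mem_iff[OF inj _ A] by simp
qed

theorem theorem4p1:
  fixes P :: "'w measure" and T :: "nat \<Rightarrow> 'w \<Rightarrow> ereal" and J :: "nat \<Rightarrow> 'w \<Rightarrow> nat"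
    and v :: "nat \<Rightarrow> real ^ 'd" and M H R :: nat and I :: "nat set"
    and lam :: "real \<Rightarrow> real" and \<alpha> :: real
    and p :: "nat \<Rightarrow> real" and q :: "nat \<Rightarrow> nat \<Rightarrow> real"
  assumes lam_Ck: "Ck_on M {0..} lam"
    and lam_nonneg: "\<And>s. 0 \<le> s \<Longrightarrow> 0 \<le> lam s"
    and Lam_finite: "\<And>t. 0 \<le> t \<Longrightarrow> (\<integral>\<^sup>+ s\<in>{0..t}. ennreal (lam s) \<partial>lborel) < \<infinity>"
    and driver: "velocity_driver P T lam J {..M} p q"
    and distinct_velocities: "inj_on v {..M}"
    and initial_pos: "\<And>i. i \<le> M \<Longrightarrow> 0 < p i"
    and H: "H < M"
    and I: "I \<subseteq> {..M}" "card I = H + 1"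
    and \<alpha>_pos: "0 < \<alpha>"
    and \<alpha>: "\<And>i. i \<in> I \<Longrightarrow> (\<Sum>j\<in>I. q i j) = \<alpha>"
    and R: "int R = aff_dim (convex hull (v ` I))"
  shows "R \<le> CARD('d) \<and>
    (\<exists>pr :: real ^ 'd \<Rightarrow> nat \<Rightarrow> real.
      coordinate_projection R pr \<and>
      (\<forall>t\<ge>0. inj_on pr (convex hull ((\<lambda>i. t *\<^sub>R v i) ` I))) \<and>
      (\<forall>(P' :: 'y measure) T' J'.
        velocity_driver P' T' (\<lambda>s. lam s * \<alpha>) J' I
          (\<lambda>i. p i / (\<Sum>j\<in>I. p j)) (\<lambda>i j. q i j / \<alpha>) \<longrightarrow>
        (\<forall>t\<ge>0. \<forall>A\<in>sets borel. A \<subseteq> rel_interior (convex hull ((\<lambda>i. t *\<^sub>R v i) ` I)) \<longrightarrow>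
          \<P>(\<omega> in P. motion v T J t \<omega> \<in> A
              \<bar> \<forall>j\<in>{..M} - I. displacement_count v T J j t \<omega> = 0) =
          \<P>(\<omega> in P'. motion_coords R (\<lambda>i. pr (v i)) T' J' t \<omega> \<in> pr ` A))))"
proof -
  obtain pr :: "real ^ 'd \<Rightarrow> nat \<Rightarrow> real" where pr: "coordinate_projection R pr"
      "\<And>t. inj_on pr (convex hull ((\<lambda>i. t *\<^sub>R v i) ` I))"
    using coordinate_projection_injective_on_hull[OF R] by blast
  have rate: "continuous_on {0..} lam"
  proof -
    obtain g where "\<forall>x\<in>{0..}. g 0 x = lam x" "\<forall>i\<le>M. continuous_on {0..} (g i)"
      using lam_Ck unfolding Ck_on_def by blast
    then show ?thesis using continuous_on_cong[of "{0..}" "{0..}" "g 0" lam] by auto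
  qed
  interpret X: velocity_driver P T lam J "{..M}" p q by fact
  have "R \<le> CARD('d)"
    using R aff_dim_le_DIM[of "convex hull (v ` I)"] by simp
  moreover have "\<P>(\<omega> in P. motion v T J t \<omega> \<in> A
              \<bar> \<forall>j\<in>{..M} - I. displacement_count v T J j t \<omega> = 0) =
          \<P>(\<omega> in P'. motion_coords R (\<lambda>i. pr (v i)) T' J' t \<omega> \<in> pr ` A)"
    if driver': "velocity_driver P' T' (\<lambda>s. lam s * \<alpha>) J' I
          (\<lambda>i. p i / (\<Sum>j\<in>I. p j)) (\<lambda>i j. q i j / \<alpha>)"
      and t: "0 \<le> t" and A: "A \<in> sets borel" "A \<subseteq> rel_interior (convex hull ((\<lambda>i. t *\<^sub>R v i) ` I))"
    for P' :: "'y measure" and T' J' t A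
  proof -
    have hull: "A \<subseteq> convex hull ((\<lambda>i. t *\<^sub>R v i) ` I)"
      using A(2) rel_interior_subset by blast
    have cond: "(\<forall>j\<in>{..M} - I. displacement_count v T J j t \<omega> = 0) \<longleftrightarrow>
        (\<forall>l\<le>event_count T t \<omega>. J l \<omega> \<in> I)" if "\<omega> \<in> space P" for \<omega>
      using X.chain_in[OF that] by (intro displacement_count_zero_iff distinct_velocities I) auto
    have "\<P>(\<omega> in P. motion v T J t \<omega> \<in> A
              \<bar> \<forall>j\<in>{..M} - I. displacement_count v T J j t \<omega> = 0)
        = \<P>(\<omega> in P. motion v T J t \<omega> \<in> A \<bar> \<forall>l\<le>event_count T t \<omega>. J l \<omega> \<in> I)"
      unfolding cond_prob_def using cond by (simp cong: conj_cong)
    also have "\<dots> = \<P>(\<omega> in P'. motion v T' J' t \<omega> \<in> A)"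
      by (rule conditioned_motion_law[OF rate driver driver' I(1) _ t A(1)]) (use \<alpha>_pos in simp)
    also have "\<dots> = \<P>(\<omega> in P'. motion_coords R (\<lambda>i. pr (v i)) T' J' t \<omega> \<in> pr ` A)"
      using motion_coords_in_image_iff[OF driver' pr hull t] by (simp cong: conj_cong)
    finally show ?thesis .
  qed
  ultimately show ?thesis using pr by blast
qed

end
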